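(* Let $G$ be a pseudocentral group, i.e. a group with $G=P(G)$. Then $G$ is a $BFC$-group if and only if $G$ is central-by-finite (that is, $G/Z(G)$ is finite).
   Context: For a group $G$, the pseudocentre is $P(G)=\bigcap_{x\in G}C_G(x)^G$, where $C_G(x)$ is the centralizer of $x$ in $G$ and, for a subgroup $H\leq G$, $H^G$ is the normal closure of $H$ in $G$. A group is a $BFC$-group if its conjugacy classes of elements are finite of bounded size (by a theorem of B.H. Neumann, equivalently, its commutator subgroup is finite). *)

theory Defs
  imports "HOL-Algebra.Algebra"
begin

definition centralizer :: "('a, 'b) monoid_scheme \<Rightarrow> 'a \<Rightarrow> 'a set" where
  "centralizer G x = {g \<in> carrier G. g \<otimes>\<^bsub>G\<^esub> x = x \<otimes>\<^bsub>G\<^esub> g}"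

definition group_centre :: "('a, 'b) monoid_scheme \<Rightarrow> 'a set" where
  "group_centre G = {z \<in> carrier G. \<forall>g \<in> carrier G. z \<otimes>\<^bsub>G\<^esub> g = g \<otimes>\<^bsub>G\<^esub> z}"

definition normal_closure :: "('a, 'b) monoid_scheme \<Rightarrow> 'a set \<Rightarrow> 'a set" where
  "normal_closure G H = \<Inter> {N. N \<lhd> G \<and> H \<subseteq> N}"

definition pseudocentre :: "('a, 'b) monoid_scheme \<Rightarrow> 'a set" where
  "pseudocentre G = (\<Inter>x \<in> carrier G. normal_closure G (centralizer G x))"

definition pseudocentral_group :: "('a, 'b) monoid_scheme \<Rightarrow> bool" where
  "pseudocentral_group G \<longleftrightarrow> group G \<and> carrier G = pseudocentre G"

definition conjugacy_class :: "('a, 'b) monoid_scheme \<Rightarrow> 'a \<Rightarrow> 'a set" where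
  "conjugacy_class G x = (\<lambda>g. inv\<^bsub>G\<^esub> g \<otimes>\<^bsub>G\<^esub> x \<otimes>\<^bsub>G\<^esub> g) ` carrier G"

(* finiteness is stated separately because card is 0 on infinite sets *)
definition BFC_group :: "('a, 'b) monoid_scheme \<Rightarrow> bool" where
  "BFC_group G \<longleftrightarrow> group G \<and>
     (\<exists>n::nat. \<forall>x \<in> carrier G.
        finite (conjugacy_class G x) \<and> card (conjugacy_class G x) \<le> n)"

definition central_by_finite :: "('a, 'b) monoid_scheme \<Rightarrow> bool" where
  "central_by_finite G \<longleftrightarrow> group G \<and> finite (carrier (G Mod group_centre G))"

end

(*
  By the argument of B. H. Neumann, a BFC-group has only finitely many commutators: if the class
  of a has maximal size and is {b^-1 a b | b in B} with B finite, then for u centralizing B the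
  class of u a is u times the class of a, so the commutators of u lie in a fixed finite set, and the
  centralizer of B has finite index.  An element x commuting with all commutators has a normal
  centralizer, so pseudocentrality forces x into the centre.  Hence the centre is the centralizer of
  a finite set and has finite index.
*)
theory Submission
  imports Defs
begin

context group
begin

text \<open>With products reassociated to the right by \<open>m_assoc\<close>, these cancellations
  let the simplifier settle the word identities below.\<close>

lemma inv_mult_cancel_left [simp]:
  assumes "x \<in> carrier G" "y \<in> carrier G"
  shows "inv x \<otimes> (x \<otimes> y) = y" and "x \<otimes> (inv x \<otimes> y) = y"
  using assms by (simp_all flip: m_assoc)

section \<open>Centralizers and the centre\<close>

lemma centralizer_iff_conj:
  assumes "x \<in> carrier G" "g \<in> carrier G"
  shows "g \<in> centralizer G x \<longleftrightarrow> inv g \<otimes> x \<otimes> g = x"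
proof -
  have "inv g \<otimes> x \<otimes> g = x \<longleftrightarrow> inv g \<otimes> (x \<otimes> g) = x"
    using assms by (simp add: m_assoc)
  also have "\<dots> \<longleftrightarrow> x \<otimes> g = g \<otimes> x"
    using assms by (metis inv_mult_cancel_left m_closed inv_closed)
  finally show ?thesis using assms by (auto simp: centralizer_def)
qed

lemma subgroup_centralizer:
  assumes "x \<in> carrier G"
  shows "subgroup (centralizer G x) G"
proof (rule subgroupI)
  show "centralizer G x \<subseteq> carrier G" by (auto simp: centralizer_def)
  have "\<one> \<in> centralizer G x" using assms by (simp add: centralizer_def)
  then show "centralizer G x \<noteq> {}" by blast
next
  fix g assume g: "g \<in> centralizer G x"
  then have gc: "g \<in> carrier G" and gx: "g \<otimes> x = x \<otimes> g" by (auto simp: centralizer_def)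
  have "inv g \<otimes> x = inv g \<otimes> (x \<otimes> g) \<otimes> inv g"
    using gc assms by (simp add: m_assoc)
  also have "\<dots> = x \<otimes> inv g"
    using gc assms by (simp flip: gx)
  finally show "inv g \<in> centralizer G x" using gc by (simp add: centralizer_def)
next
  fix g h assume "g \<in> centralizer G x" "h \<in> centralizer G x"
  then have gc: "g \<in> carrier G" "h \<in> carrier G" and gx: "g \<otimes> x = x \<otimes> g" "h \<otimes> x = x \<otimes> h"
    by (auto simp: centralizer_def)
  have "g \<otimes> h \<otimes> x = g \<otimes> x \<otimes> h" using gc assms by (simp add: m_assoc gx(2))
  also have "\<dots> = x \<otimes> (g \<otimes> h)" using gc assms by (simp add: m_assoc gx(1))
  finally show "g \<otimes> h \<in> centralizer G x" using gc by (simp add: centralizer_def)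
qed

lemma group_centre_subset: "group_centre G \<subseteq> carrier G"
  by (auto simp: group_centre_def)

text \<open>Presents the centre as an intersection of subgroups; \<open>one_closed\<close> makes the
  index set nonempty, which keeps the intersection inside the carrier.\<close>

lemma group_centre_eq_Inter:
  "group_centre G = (\<Inter>x\<in>carrier G. centralizer G x)"
  using one_closed by (force simp: group_centre_def centralizer_def)

lemma subgroup_group_centre: "subgroup (group_centre G) G"
  unfolding group_centre_eq_Inter
  by (rule subgroups_Inter) (use subgroup_centralizer in auto)

section \<open>Finite index of centralizers and finiteness of the set of commutators\<close>

lemma conj_eq_imp_centralizer:
  assumes "x \<in> carrier G" "g \<in> carrier G" "h \<in> carrier G"
    and eq: "inv g \<otimes> x \<otimes> g = inv h \<otimes> x \<otimes> h"
  shows "h \<otimes> inv g \<in> centralizer G x"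
proof -
  have "inv (h \<otimes> inv g) \<otimes> x \<otimes> (h \<otimes> inv g) = g \<otimes> (inv h \<otimes> x \<otimes> h) \<otimes> inv g"
    using assms(1-3) by (simp add: inv_mult_group m_assoc)
  also have "\<dots> = x"
    using assms(1-3) by (simp flip: eq) (simp add: m_assoc)
  finally show ?thesis using assms by (simp add: centralizer_iff_conj)
qed

text \<open>\<open>R\<close> meets every right coset of the common centralizer of \<open>B\<close>.
  The coset of \<open>h\<close> is determined by the conjugates of the elements of \<open>B\<close>
  by \<open>h\<close>, and these can take only finitely many values.\<close>

lemma finite_index_centralizer:
  assumes "finite B" "B \<subseteq> carrier G" "\<And>b. b \<in> B \<Longrightarrow> finite (conjugacy_class G b)"
  shows "\<exists>R. finite R \<and> R \<subseteq> carrier G \<and>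
    (\<forall>h\<in>carrier G. \<exists>r\<in>R. \<forall>b\<in>B. h \<otimes> inv r \<in> centralizer G b)"
proof -
  define \<phi> where "\<phi> h = restrict (\<lambda>b. inv h \<otimes> b \<otimes> h) B" for h
  have "\<phi> ` carrier G \<subseteq> (\<Pi>\<^sub>E b\<in>B. conjugacy_class G b)"
    by (auto simp: \<phi>_def conjugacy_class_def)
  then have fin: "finite (\<phi> ` carrier G)"
    by (rule finite_subset) (simp add: assms(1,3) finite_PiE)
  \<comment> \<open>\<open>R\<close> picks one element from each fibre of \<open>\<phi>\<close>, so
    it is as finite as the image.\<close>
  obtain R where R: "R \<subseteq> carrier G" "inj_on \<phi> R" "\<phi> ` carrier G = \<phi> ` R"
    using subset_image_inj[of "\<phi> ` carrier G" \<phi> "carrier G"] by (metis order_refl)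
  show ?thesis
  proof (intro exI conjI ballI)
    show "finite R" using fin R finite_imageD by metis
    show "R \<subseteq> carrier G" by fact
    fix h assume h: "h \<in> carrier G"
    then obtain r where r: "r \<in> R" "\<phi> h = \<phi> r" using R(3) by (metis imageE imageI)
    have "h \<otimes> inv r \<in> centralizer G b" if "b \<in> B" for b
    proof (rule conj_eq_imp_centralizer)
      show "inv r \<otimes> b \<otimes> r = inv h \<otimes> b \<otimes> h"
        using fun_cong[OF r(2), of b] that by (simp add: \<phi>_def)
    qed (use that assms(2) r R h in auto)
    then show "\<exists>r\<in>R. \<forall>b\<in>B. h \<otimes> inv r \<in> centralizer G b" using r(1) by blast
  qed
qed

text \<open>The elements \<open>u \<otimes> (inv b \<otimes> a \<otimes> b)\<close> are as many
  members of the class of \<open>u \<otimes> a\<close> as the class of \<open>a\<close> has, so by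
  \<open>le\<close> they exhaust it. Comparing one of them with the conjugate of
  \<open>u \<otimes> a\<close> by \<open>g\<close> writes the commutator as a quotient of two
  conjugates of \<open>a\<close>, which confines it to a set independent of
  \<open>u\<close>.\<close>

lemma commutator_in_conj_quotients:
  assumes a: "a \<in> carrier G" and B: "B \<subseteq> carrier G"
    and inj: "inj_on (\<lambda>b. inv b \<otimes> a \<otimes> b) B"
    and img: "conjugacy_class G a = (\<lambda>b. inv b \<otimes> a \<otimes> b) ` B"
    and u: "u \<in> carrier G" "\<And>b. b \<in> B \<Longrightarrow> u \<in> centralizer G b"
    and fin: "finite (conjugacy_class G (u \<otimes> a))"
    and le: "card (conjugacy_class G (u \<otimes> a)) \<le> card (conjugacy_class G a)"
    and g: "g \<in> carrier G"
  shows "inv u \<otimes> (inv g \<otimes> u \<otimes> g) \<in>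
    (\<lambda>(s, t). s \<otimes> inv t) ` (conjugacy_class G a \<times> conjugacy_class G a)"
proof -
  have conj_u: "inv b \<otimes> (u \<otimes> a) \<otimes> b = u \<otimes> (inv b \<otimes> a \<otimes> b)" if "b \<in> B" for b
  proof -
    have "b \<in> carrier G" using that B by blast
    then have "inv b \<in> centralizer G u"
      using u(2)[OF that] u(1)
      by (intro subgroup.m_inv_closed[OF subgroup_centralizer]) (auto simp: centralizer_def)
    then have "inv b \<otimes> u = u \<otimes> inv b" by (simp add: centralizer_def)
    then have "inv b \<otimes> u \<otimes> (a \<otimes> b) = u \<otimes> inv b \<otimes> (a \<otimes> b)" by simp
    then show ?thesis using u a \<open>b \<in> carrier G\<close> by (simp add: m_assoc)
  qed
  have "inj_on (\<lambda>b. inv b \<otimes> (u \<otimes> a) \<otimes> b) B"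
  proof (rule inj_onI)
    fix b c assume bc: "b \<in> B" "c \<in> B"
      and eq: "inv b \<otimes> (u \<otimes> a) \<otimes> b = inv c \<otimes> (u \<otimes> a) \<otimes> c"
    have "b \<in> carrier G" "c \<in> carrier G" using bc B by auto
    then have "inv b \<otimes> a \<otimes> b = inv c \<otimes> a \<otimes> c"
      using eq u a bc by (simp add: conj_u)
    then show "b = c" using inj bc by (auto dest: inj_onD)
  qed
  then have "card ((\<lambda>b. inv b \<otimes> (u \<otimes> a) \<otimes> b) ` B) = card (conjugacy_class G a)"
    using inj by (simp add: card_image img)
  moreover have "(\<lambda>b. inv b \<otimes> (u \<otimes> a) \<otimes> b) ` B \<subseteq> conjugacy_class G (u \<otimes> a)"
    using B by (auto simp: conjugacy_class_def)
  ultimately have "(\<lambda>b. inv b \<otimes> (u \<otimes> a) \<otimes> b) ` B = conjugacy_class G (u \<otimes> a)"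
    using card_seteq[OF fin] le by metis
  moreover have "inv g \<otimes> (u \<otimes> a) \<otimes> g \<in> conjugacy_class G (u \<otimes> a)"
    using g by (auto simp: conjugacy_class_def)
  ultimately obtain b where b: "b \<in> B"
    and eq: "inv g \<otimes> (u \<otimes> a) \<otimes> g = inv b \<otimes> (u \<otimes> a) \<otimes> b"
    by blast
  have bc: "b \<in> carrier G" using b B by blast
  \<comment> \<open>The conjugate of \<open>a\<close> by \<open>g\<close> is inserted and divided
    out again, so that the conjugate of \<open>u \<otimes> a\<close> appears.\<close>
  have "inv u \<otimes> (inv g \<otimes> u \<otimes> g) = inv u \<otimes> (inv g \<otimes> (u \<otimes> a) \<otimes> g) \<otimes> inv (inv g \<otimes> a \<otimes> g)"
    using a u g by (simp add: inv_mult_group m_assoc)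
  also have "\<dots> = (inv b \<otimes> a \<otimes> b) \<otimes> inv (inv g \<otimes> a \<otimes> g)"
    using a u g bc b by (simp add: eq conj_u)
  finally have "inv u \<otimes> (inv g \<otimes> u \<otimes> g) = (inv b \<otimes> a \<otimes> b) \<otimes> inv (inv g \<otimes> a \<otimes> g)" .
  moreover have "inv b \<otimes> a \<otimes> b \<in> conjugacy_class G a" "inv g \<otimes> a \<otimes> g \<in> conjugacy_class G a"
    using g bc by (auto simp: conjugacy_class_def)
  ultimately show ?thesis
    by (intro image_eqI[where x = "(inv b \<otimes> a \<otimes> b, inv g \<otimes> a \<otimes> g)"]) (simp_all only: split_conv mem_Sigma_iff)
qed

text \<open>The identity [ur,g] = u[r,g]u^-1 [u,g], with [r,g] bracketed as \<open>r\<close> times a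
  conjugate of \<open>inv r\<close>.\<close>

lemma commutator_mult_left:
  assumes "u \<in> carrier G" "r \<in> carrier G" "g \<in> carrier G"
  shows "(u \<otimes> r) \<otimes> g \<otimes> inv (u \<otimes> r) \<otimes> inv g =
    (u \<otimes> (r \<otimes> (g \<otimes> inv r \<otimes> inv g)) \<otimes> inv u) \<otimes> (u \<otimes> g \<otimes> inv u \<otimes> inv g)"
  using assms by (simp add: inv_mult_group m_assoc)

lemma inv_conj_in_conjugacy_class:
  assumes "g \<in> carrier G"
  shows "g \<otimes> x \<otimes> inv g \<in> conjugacy_class G x"
  unfolding conjugacy_class_def using assms by (intro image_eqI[of _ _ "inv g"]) auto

text \<open>Every \<open>h\<close> factors as \<open>u \<otimes> r\<close> with \<open>u\<close>
  centralizing \<open>B\<close> and \<open>r\<close> in a finite set. Then u[r,g]u^-1 falls into a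
  finite set by finiteness of classes, and [u,g] by the maximality of the class of
  \<open>a\<close>.\<close>

lemma BFC_imp_finite_commutators:
  assumes "BFC_group G"
  shows "finite (derived_set G (carrier G))"
proof -
  obtain n where fin: "\<And>x. x \<in> carrier G \<Longrightarrow> finite (conjugacy_class G x)"
    and n: "\<And>x. x \<in> carrier G \<Longrightarrow> card (conjugacy_class G x) \<le> n"
    using assms by (auto simp: BFC_group_def)
  obtain a where a: "a \<in> carrier G"
    and max: "\<And>x. x \<in> carrier G \<Longrightarrow> card (conjugacy_class G x) \<le> card (conjugacy_class G a)"
    using ex_has_greatest_nat[of "\<lambda>x. x \<in> carrier G" \<one> "\<lambda>x. card (conjugacy_class G x)" "Suc n"] n
    by (metis one_closed less_Suc_eq_le)
  \<comment> \<open>\<open>B\<close> contains exactly one conjugating element for each member of the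
    class of \<open>a\<close>.\<close>
  obtain B where B: "B \<subseteq> carrier G" "inj_on (\<lambda>b. inv b \<otimes> a \<otimes> b) B"
    "conjugacy_class G a = (\<lambda>b. inv b \<otimes> a \<otimes> b) ` B"
    using subset_image_inj[THEN iffD1, OF equalityD1, OF conjugacy_class_def[of G a]] by meson
  have "finite B" using fin[OF a] B finite_imageD by metis
  moreover have "finite (conjugacy_class G b)" if "b \<in> B" for b
    using that fin B(1) by blast
  ultimately obtain R where R: "finite R" "R \<subseteq> carrier G"
    "\<forall>h\<in>carrier G. \<exists>r\<in>R. \<forall>b\<in>B. h \<otimes> inv r \<in> centralizer G b"
    using finite_index_centralizer[of B] B(1) by meson
  define F where "F = (\<lambda>(s, t). s \<otimes> inv t) ` (conjugacy_class G a \<times> conjugacy_class G a)"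
  \<comment> \<open>\<open>s\<close> runs over the conjugates of \<open>inv r\<close>, so
    \<open>r \<otimes> s\<close> covers every [r,g]; the outer class absorbs conjugation by
    \<open>u\<close>.\<close>
  define E where "E = (\<Union>r\<in>R. \<Union>s\<in>conjugacy_class G (inv r). conjugacy_class G (r \<otimes> s))"
  have "finite F" unfolding F_def using fin[OF a] by simp
  moreover have "finite E"
    unfolding E_def using R(1,2) fin by (intro finite_UN_I) (auto simp: conjugacy_class_def)
  moreover have "derived_set G (carrier G) \<subseteq> (\<lambda>(x, y). x \<otimes> y) ` (E \<times> F)"
  proof
    fix k assume "k \<in> derived_set G (carrier G)"
    then obtain h g where hg: "h \<in> carrier G" "g \<in> carrier G" and k: "k = h \<otimes> g \<otimes> inv h \<otimes> inv g"
      by blast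
    obtain r where r: "r \<in> R" "\<And>b. b \<in> B \<Longrightarrow> h \<otimes> inv r \<in> centralizer G b"
      using R(3) hg(1) by blast
    have rc: "r \<in> carrier G" using r R by blast
    define u where "u = h \<otimes> inv r"
    have u: "u \<in> carrier G" using hg rc by (simp add: u_def)
    have h: "h = u \<otimes> r" using hg rc by (simp add: u_def m_assoc)
    have "u \<otimes> (r \<otimes> (g \<otimes> inv r \<otimes> inv g)) \<otimes> inv u \<in> E"
      unfolding E_def using r(1) inv_conj_in_conjugacy_class hg u by blast
    \<comment> \<open>Taking inverses of \<open>u\<close> and \<open>g\<close> turns u^-1 g^-1 u g
      into u g u^-1 g^-1, the form used by \<open>derived_set\<close>.\<close>
    moreover have "inv (inv u) \<otimes> (inv (inv g) \<otimes> inv u \<otimes> inv g) \<in> F"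
      unfolding F_def
    proof (rule commutator_in_conj_quotients[OF a B])
      show "inv u \<in> centralizer G b" if "b \<in> B" for b
        using subgroup.m_inv_closed[OF subgroup_centralizer] r(2) that B(1) by (auto simp: u_def)
    qed (use u a hg fin max in auto)
    then have "u \<otimes> g \<otimes> inv u \<otimes> inv g \<in> F" using u hg by (simp add: m_assoc)
    ultimately show "k \<in> (\<lambda>(x, y). x \<otimes> y) ` (E \<times> F)"
      unfolding k h commutator_mult_left[OF u rc hg(2)] by (metis SigmaI image_eqI split_conv)
  qed
  ultimately show ?thesis by (meson finite_SigmaI finite_imageI finite_subset)
qed

section \<open>Central index: the two implications\<close>

lemma normal_centralizer:
  assumes x: "x \<in> carrier G" and K: "derived_set G (carrier G) \<subseteq> centralizer G x"
  shows "centralizer G x \<lhd> G"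
  unfolding normal_inv_iff
proof (intro conjI ballI)
  show S: "subgroup (centralizer G x) G" using subgroup_centralizer[OF x] .
  fix g c assume g: "g \<in> carrier G" and c: "c \<in> centralizer G x"
  then have cc: "c \<in> carrier G" by (simp add: centralizer_def)
  \<comment> \<open>A conjugate of \<open>c\<close> is a commutator times \<open>c\<close>, so a
    subgroup containing all commutators is normal.\<close>
  have "g \<otimes> c \<otimes> inv g \<otimes> inv c \<in> centralizer G x" using K g cc by blast
  then have "g \<otimes> c \<otimes> inv g \<otimes> inv c \<otimes> c \<in> centralizer G x"
    using c by (rule subgroup.m_closed[OF S])
  then show "g \<otimes> c \<otimes> inv g \<in> centralizer G x" using g cc by (simp add: m_assoc)
qed

text \<open>The centralizer of \<open>x\<close> is normal, hence equal to its normal closure, and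
  pseudocentrality makes that closure the whole group.\<close>

lemma pseudocentral_centralizes_commutators_imp_centre:
  assumes "pseudocentral_group G" and x: "x \<in> carrier G"
    and "derived_set G (carrier G) \<subseteq> centralizer G x"
  shows "x \<in> group_centre G"
proof -
  have "normal_closure G (centralizer G x) \<subseteq> centralizer G x"
    using normal_centralizer[OF x assms(3)] by (auto simp: normal_closure_def)
  moreover have "carrier G \<subseteq> normal_closure G (centralizer G x)"
    using assms(1) x by (auto simp: pseudocentral_group_def pseudocentre_def)
  ultimately have "carrier G \<subseteq> centralizer G x" by blast
  then show ?thesis using x by (force simp: group_centre_def centralizer_def)
qed

lemma pseudocentral_BFC_imp_central_by_finite:
  assumes P: "pseudocentral_group G" and "BFC_group G"
  shows "central_by_finite G"
proof -
  let ?Z = "group_centre G"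
  define K where "K = derived_set G (carrier G)"
  have K: "K \<subseteq> carrier G" unfolding K_def by auto
  have "finite K" unfolding K_def using assms(2) by (rule BFC_imp_finite_commutators)
  moreover have "finite (conjugacy_class G k)" if "k \<in> K" for k
    using assms(2) K that by (auto simp: BFC_group_def)
  ultimately obtain R where R: "finite R" "R \<subseteq> carrier G"
    "\<forall>h\<in>carrier G. \<exists>r\<in>R. \<forall>k\<in>K. h \<otimes> inv r \<in> centralizer G k"
    using finite_index_centralizer[of K] K by meson
  \<comment> \<open>\<open>R\<close> represents the cosets of the common centralizer of all
    commutators, which lies in the centre; hence it meets every coset of the centre.\<close>
  have "rcosets ?Z \<subseteq> (\<lambda>r. ?Z #> r) ` R"
  proof
    fix C assume "C \<in> rcosets ?Z"
    then obtain h where h: "h \<in> carrier G" "C = ?Z #> h" by (auto simp: RCOSETS_def)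
    obtain r where r: "r \<in> R" "\<And>k. k \<in> K \<Longrightarrow> h \<otimes> inv r \<in> centralizer G k"
      using R(3) h(1) by blast
    have rc: "r \<in> carrier G" using r R by blast
    \<comment> \<open>Commuting is symmetric: \<open>h \<otimes> inv r\<close> centralizes
      \<open>K\<close>, so \<open>K\<close> centralizes it.\<close>
    have "K \<subseteq> centralizer G (h \<otimes> inv r)"
    proof
      fix k assume k: "k \<in> K"
      then show "k \<in> centralizer G (h \<otimes> inv r)"
        using r(2)[OF k] K by (auto simp: centralizer_def)
    qed
    then have z: "h \<otimes> inv r \<in> ?Z"
      using P h rc unfolding K_def by (intro pseudocentral_centralizes_commutators_imp_centre) auto
    have "h \<in> ?Z #> r"
      using rcosI[OF z group_centre_subset rc] h rc by (simp add: m_assoc)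
    then have "?Z #> r = ?Z #> h" using rc by (intro repr_independence subgroup_group_centre)
    then show "C \<in> (\<lambda>r. ?Z #> r) ` R" using h r by blast
  qed
  then have "finite (rcosets ?Z)" using R(1) by (meson finite_imageI finite_subset)
  then show ?thesis using is_group by (simp add: central_by_finite_def FactGroup_def)
qed

text \<open>The conjugate of \<open>x\<close> by \<open>g\<close> depends only on the coset of
  \<open>g\<close> modulo the centre, so the index of the centre bounds all class sizes at
  once.\<close>

lemma central_by_finite_imp_BFC:
  assumes "central_by_finite G"
  shows "BFC_group G"
proof -
  let ?Z = "group_centre G"
  have fin: "finite (rcosets ?Z)"
    using assms by (simp add: central_by_finite_def FactGroup_def)
  \<comment> \<open>\<open>SOME\<close> picks an arbitrary representative of the coset; the central
    factor by which it differs from \<open>h\<close> cancels in the conjugate.\<close>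
  have "conjugacy_class G x \<subseteq> (\<lambda>C. let g = SOME g. g \<in> C in inv g \<otimes> x \<otimes> g) ` (rcosets ?Z)"
    if x: "x \<in> carrier G" for x
  proof
    fix y assume "y \<in> conjugacy_class G x"
    then obtain h where h: "h \<in> carrier G" "y = inv h \<otimes> x \<otimes> h"
      by (auto simp: conjugacy_class_def)
    define g where "g = (SOME g. g \<in> ?Z #> h)"
    have "h \<in> ?Z #> h" using h subgroup_group_centre rcos_self by blast
    then have "g \<in> ?Z #> h" unfolding g_def by (rule someI)
    then obtain z where z: "z \<in> ?Z" "g = z \<otimes> h" by (auto simp: r_coset_def)
    have zc: "z \<in> carrier G" using z group_centre_subset by blast
    have zx: "inv z \<otimes> x \<otimes> z = x"
      using z zc x centralizer_iff_conj by (auto simp: group_centre_eq_Inter)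
    have "inv g \<otimes> x \<otimes> g = inv h \<otimes> (inv z \<otimes> x \<otimes> z) \<otimes> h"
      using z(2) zc h x by (simp add: inv_mult_group m_assoc)
    then have "y = inv g \<otimes> x \<otimes> g" using h by (simp add: zx)
    moreover have "?Z #> h \<in> rcosets ?Z" using h by (auto simp: RCOSETS_def)
    ultimately show "y \<in> (\<lambda>C. let g = SOME g. g \<in> C in inv g \<otimes> x \<otimes> g) ` (rcosets ?Z)"
      unfolding g_def by (auto simp: Let_def)
  qed
  then have "finite (conjugacy_class G x) \<and> card (conjugacy_class G x) \<le> card (rcosets ?Z)"
    if "x \<in> carrier G" for x
    using that fin by (meson finite_surj surj_card_le)
  then show ?thesis using is_group by (auto simp: BFC_group_def)
qed

end

theorem theorem2p31:
  fixes G :: "('a, 'b) monoid_scheme"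
  assumes "pseudocentral_group G"
  shows "BFC_group G \<longleftrightarrow> central_by_finite G"
proof -
  interpret group G using assms by (simp add: pseudocentral_group_def)
  show ?thesis
    using assms pseudocentral_BFC_imp_central_by_finite central_by_finite_imp_BFC by blast
qed

end
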